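(* Let $A\colon[0,+\infty)\to M_n(\mathbb{R})$ and $f\colon[0,+\infty)\times\mathbb{R}^n\to\mathbb{R}^n$ be continuous, and consider the systems $$\text{(L)}\ \ \dot x=A(t)x,\qquad \text{(N)}\ \ \dot y=A(t)y+f(t,y),\qquad t\ge0.$$ Let $X(t,s)$ be the transition matrix of (L) and assume: (A1) $\sup_{t\ge0}\|A(t)\|=M<+\infty$; (A2) there is $\mu>0$ with $|f(t,y)|\le\mu$ for all $t\ge0$, $y\in\mathbb{R}^n$; (A3) there is $\gamma>0$ with $|f(t,y)-f(t,y')|\le\gamma|y-y'|$ for all $t\ge0$, $y,y'\in\mathbb{R}^n$; (A4) (L) has an exponential dichotomy on $[0,+\infty)$ with projection $P=I$ and constants $K,\alpha>0$, that is, $\|X(t,s)\|\le Ke^{-\alpha(t-s)}$ for all $t\ge s\ge0$, and $2K\gamma<\alpha$. Then (L) and (N) are $\mathbb{R}^+$-continuously topologically equivalent, where $\mathbb{R}^+=[0,+\infty)$.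
   Context: $|\cdot|$ is a norm on $\mathbb{R}^n$ and $\|\cdot\|$ the induced operator norm. The transition matrix is $X(t,s)=X(t)X^{-1}(s)$ for a fundamental matrix $X(t)$. Definition. For an interval $J\subseteq\mathbb{R}$, the systems (L) and (N) are $J$-continuously topologically equivalent if there exists $H\colon J\times\mathbb{R}^n\to\mathbb{R}^n$ such that: (i) if $t\mapsto x(t)$ is a solution of (L), then $t\mapsto H(t,x(t))$ is a solution of (N); (ii) $H(t,u)-u$ is bounded on $J\times\mathbb{R}^n$; (iii) for each fixed $t\in J$, $u\mapsto H(t,u)$ is a homeomorphism of $\mathbb{R}^n$; (iv) $H$ is continuous at every $(t,u)\in J\times\mathbb{R}^n$; and, in addition, the function $G$ defined by letting $G(t,\cdot)$ be the inverse of $H(t,\cdot)$ has properties (ii)–(iv) and maps solutions of (N) into solutions of (L). *)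

theory Defs
  imports "HOL-Analysis.Analysis"
begin

text \<open>An arbitrary norm on \<open>\<real>\<^sup>n\<close>, by the same laws as the class \<open>real_normed_vector\<close>; it need
  not be the Euclidean norm of \<open>real ^ 'n\<close>. Continuity and derivatives below refer to the usual
  topology of \<open>real ^ 'n\<close>, which every norm induces.\<close>

definition norm_fun :: "(real ^ 'n \<Rightarrow> real) \<Rightarrow> bool" where
  "norm_fun nrm \<longleftrightarrow>
     (\<forall>x. 0 \<le> nrm x) \<and>
     (\<forall>x. nrm x = 0 \<longleftrightarrow> x = 0) \<and>
     (\<forall>c x. nrm (c *\<^sub>R x) = \<bar>c\<bar> * nrm x) \<and>
     (\<forall>x y. nrm (x + y) \<le> nrm x + nrm y)"

text \<open>The induced operator norm, following \<^const>\<open>onorm\<close>; the quotient at \<open>x = 0\<close> is \<open>0\<close>.\<close>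

definition op_norm :: "(real ^ 'n \<Rightarrow> real) \<Rightarrow> real ^ 'n ^ 'n \<Rightarrow> real" where
  "op_norm nrm A = (SUP x. nrm (A *v x) / nrm x)"

text \<open>Solutions are defined on the whole of \<open>J\<close>, with one-sided derivatives at end points.\<close>

definition ode_solution ::
    "real set \<Rightarrow> (real \<Rightarrow> real ^ 'n \<Rightarrow> real ^ 'n) \<Rightarrow> (real \<Rightarrow> real ^ 'n) \<Rightarrow> bool" where
  "ode_solution J F x \<longleftrightarrow> (\<forall>t\<in>J. (x has_vector_derivative F t (x t)) (at t within J))"

definition fundamental_matrix ::
    "real set \<Rightarrow> (real \<Rightarrow> real ^ 'n ^ 'n) \<Rightarrow> (real \<Rightarrow> real ^ 'n ^ 'n) \<Rightarrow> bool" where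
  "fundamental_matrix J A X \<longleftrightarrow>
     (\<forall>t\<in>J. (X has_vector_derivative A t ** X t) (at t within J) \<and> invertible (X t))"

definition transition_matrix ::
    "real set \<Rightarrow> (real \<Rightarrow> real ^ 'n ^ 'n) \<Rightarrow> (real \<Rightarrow> real \<Rightarrow> real ^ 'n ^ 'n) \<Rightarrow> bool" where
  "transition_matrix J A \<Phi> \<longleftrightarrow>
     (\<exists>X. fundamental_matrix J A X \<and> (\<forall>t\<in>J. \<forall>s\<in>J. \<Phi> t s = X t ** matrix_inv (X s)))"

text \<open>No joint homeomorphism of \<open>J \<times> \<real>\<^sup>n\<close> is asked for; the values \<open>H t\<close> only
  matter for \<open>t \<in> J\<close>.\<close>

definition near_identity_homeos ::
    "(real ^ 'n \<Rightarrow> real) \<Rightarrow> real set \<Rightarrow> (real \<Rightarrow> real ^ 'n \<Rightarrow> real ^ 'n) \<Rightarrow> bool" where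
  "near_identity_homeos nrm J H \<longleftrightarrow>
     (\<exists>B. \<forall>t\<in>J. \<forall>u. nrm (H t u - u) \<le> B) \<and>
     (\<forall>t\<in>J. \<exists>g. homeomorphism UNIV UNIV (H t) g) \<and>
     continuous_on (J \<times> UNIV) (\<lambda>(t, u). H t u)"

definition maps_solutions ::
    "real set \<Rightarrow> (real \<Rightarrow> real ^ 'n \<Rightarrow> real ^ 'n) \<Rightarrow> (real \<Rightarrow> real ^ 'n \<Rightarrow> real ^ 'n) \<Rightarrow>
     (real \<Rightarrow> real ^ 'n \<Rightarrow> real ^ 'n) \<Rightarrow> bool" where
  "maps_solutions J F F' H \<longleftrightarrow>
     (\<forall>x. ode_solution J F x \<longrightarrow> ode_solution J F' (\<lambda>t. H t (x t)))"

definition continuously_topologically_equivalent ::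
    "(real ^ 'n \<Rightarrow> real) \<Rightarrow> real set \<Rightarrow> (real \<Rightarrow> real ^ 'n \<Rightarrow> real ^ 'n) \<Rightarrow>
     (real \<Rightarrow> real ^ 'n \<Rightarrow> real ^ 'n) \<Rightarrow> bool" where
  "continuously_topologically_equivalent nrm J F F' \<longleftrightarrow>
     (\<exists>H. maps_solutions J F F' H \<and> near_identity_homeos nrm J H \<and>
          maps_solutions J F' F (\<lambda>t. inv (H t)) \<and> near_identity_homeos nrm J (\<lambda>t. inv (H t)))"

end

theory Submission
  imports Defs
begin

text \<open>Since (A1) and (A3) make both vector fields globally Lipschitz, both systems have flows
  \<open>\<Phi>\<close> (linear) and \<open>\<Psi>\<close> (perturbed) from time \<open>0\<close>, and \<open>H t = \<Psi> t \<circ> (\<Phi> t)\<^sup>-\<^sup>1\<close> carries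
  solutions to solutions. By variation of constants
  \<open>\<Psi> t \<xi> - \<Phi> t \<xi> = \<integral>\<^sub>0\<^sup>t X t s *v f s (\<Psi> s \<xi>) ds\<close>, which (A2) and (A4) bound by \<open>K \<mu> / \<alpha>\<close>,
  so \<open>H t\<close> and its inverse stay at bounded distance from the identity.\<close>

section \<open>Matrix products as bounded linear maps, and one-sided derivatives\<close>

lemma bounded_bilinear_matrix_vector:
  "bounded_bilinear ((*v) :: real^'n^'m \<Rightarrow> real^'n \<Rightarrow> real^'m)"
  unfolding bilinear_conv_bounded_bilinear[symmetric] bilinear_def
  by (auto intro!: linearI simp: matrix_vector_right_distrib matrix_vector_mult_add_rdistrib
      scaleR_matrix_vector_assoc matrix_vector_mult_scaleR)

lemma bounded_linear_matrix_mult_right: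
  "bounded_linear (\<lambda>B :: real^'n^'m. B ** (C :: real^'k^'n))"
  unfolding linear_conv_bounded_linear[symmetric]
  by (auto intro!: linearI simp: vec_eq_iff matrix_matrix_mult_def algebra_simps sum.distrib
      sum_distrib_left)

text \<open>Near \<open>t\<close> the half-line and the interval \<open>{a..t+1}\<close> coincide.
  This carries the fundamental theorem of calculus, which concerns compact intervals, over to
  \<open>{a..}\<close>.\<close>

lemma has_vector_derivative_within_atLeastI:
  fixes x :: "real \<Rightarrow> 'a::real_normed_vector"
  assumes "\<And>T. t < T \<Longrightarrow> (x has_vector_derivative v) (at t within {a..T})" "a \<le> t"
  shows "(x has_vector_derivative v) (at t within {a..})"
proof -
  have "at t within {a..} = at t within {a..t+1}"
    by (rule at_within_nhd[of _ "{..<t+1}"]) auto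
  then show ?thesis using assms(1)[of "t+1"] by simp
qed

lemma nondecreasing_within:
  fixes g :: "real \<Rightarrow> real"
  assumes "a \<le> b"
    and d: "\<And>t. t \<in> {a..b} \<Longrightarrow> (g has_vector_derivative g' t) (at t within {a..b})"
    and nn: "\<And>t. t \<in> {a..b} \<Longrightarrow> g' t \<ge> 0"
  shows "g a \<le> g b"
proof (rule DERIV_nonneg_imp_increasing_open[OF \<open>a \<le> b\<close>])
  fix t assume t: "a < t" "t < b"
  then have "at t within {a..b} = at t"
    by (intro at_within_interior) auto
  then show "\<exists>y. (g has_real_derivative y) (at t) \<and> 0 \<le> y"
    using d[of t] nn[of t] t by (auto simp: has_real_derivative_iff_has_vector_derivative)
next
  show "continuous_on {a..b} g"
    unfolding continuous_on_eq_continuous_within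
    using d has_vector_derivative_continuous by blast
qed

section \<open>Globally Lipschitz equations: dependence on data and global existence\<close>

text \<open>A Gronwall estimate in both time directions. By Cauchy-Schwarz the derivative of the
  squared distance \<open>d t \<bullet> d t\<close> is at most \<open>2 * L\<close> times that
  distance in absolute value, so an exponential weight makes it monotone. The second inequality
  later yields injectivity of the flow and control of its inverse.\<close>

lemma lipschitz_ode_dependence:
  fixes F :: "real \<Rightarrow> 'a::real_inner \<Rightarrow> 'a"
  assumes T: "0 \<le> T"
    and lip: "\<And>t x y. t \<in> {0..T} \<Longrightarrow> norm (F t x - F t y) \<le> L * norm (x - y)"
    and x: "\<And>t. t \<in> {0..T} \<Longrightarrow> (x has_vector_derivative F t (x t)) (at t within {0..T})"
    and y: "\<And>t. t \<in> {0..T} \<Longrightarrow> (y has_vector_derivative F t (y t)) (at t within {0..T})"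
  shows "norm (x T - y T) \<le> exp (L * T) * norm (x 0 - y 0)"
    and "norm (x 0 - y 0) \<le> exp (L * T) * norm (x T - y T)"
proof -
  define d where "d t = x t - y t" for t
  define d' where "d' t = F t (x t) - F t (y t)" for t
  have d: "(d has_vector_derivative d' t) (at t within {0..T})" if "t \<in> {0..T}" for t
    unfolding d_def d'_def using x[OF that] y[OF that] by (rule has_vector_derivative_diff)
  have le: "\<bar>d t \<bullet> d' t\<bar> \<le> L * (d t \<bullet> d t)" if "t \<in> {0..T}" for t
  proof -
    have "\<bar>d t \<bullet> d' t\<bar> \<le> norm (d t) * norm (d' t)"
      by (rule Cauchy_Schwarz_ineq2)
    also have "\<dots> \<le> norm (d t) * (L * norm (d t))"
      using lip[OF that] by (intro mult_left_mono) (auto simp: d_def d'_def)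
    also have "\<dots> = L * (d t \<bullet> d t)"
      by (simp add: dot_square_norm power2_eq_square)
    finally show ?thesis .
  qed
  have dd: "((\<lambda>t. d t \<bullet> d t) has_vector_derivative 2 * (d t \<bullet> d' t)) (at t within {0..T})"
    if "t \<in> {0..T}" for t
    using bounded_bilinear.has_vector_derivative[OF bounded_bilinear_inner d[OF that] d[OF that]]
    by (simp add: inner_commute)
  \<comment> \<open>Taken with \<open>c = - 2 * L\<close> and with \<open>c = 2 * L\<close>: by
    \<open>le\<close> the derivative is then nonpositive in the first case and nonnegative in the
    second.\<close>
  have de: "((\<lambda>t. exp (c * t) * (d t \<bullet> d t)) has_vector_derivative
      exp (c * t) * (2 * (d t \<bullet> d' t) + c * (d t \<bullet> d t))) (at t within {0..T})"
    if "t \<in> {0..T}" for t c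
    using dd[OF that] unfolding has_real_derivative_iff_has_vector_derivative[symmetric]
    by (auto intro!: derivative_eq_intros simp: algebra_simps)
  have sq: "a \<le> exp (L * T) * b" if "a^2 \<le> exp (2 * L * T) * b^2" "0 \<le> b" for a b :: real
  proof (rule power2_le_imp_le)
    show "a^2 \<le> (exp (L * T) * b)^2"
      using that by (simp add: power_mult_distrib mult.assoc flip: exp_double)
  qed (use that in auto)
  have "- (exp (- 2 * L * 0) * (d 0 \<bullet> d 0)) \<le> - (exp (- 2 * L * T) * (d T \<bullet> d T))"
    by (rule nondecreasing_within[OF T has_vector_derivative_minus[OF de]])
      (use le in \<open>auto simp: mult_le_0_iff abs_le_iff algebra_simps\<close>)
  then have "exp (- (2 * L * T)) * norm (d T)^2 \<le> norm (d 0)^2"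
    by (simp add: dot_square_norm)
  then have "norm (d T)^2 \<le> exp (2 * L * T) * norm (d 0)^2"
    by (simp add: exp_minus field_simps)
  from sq[OF this] show "norm (x T - y T) \<le> exp (L * T) * norm (x 0 - y 0)"
    by (simp add: d_def)
  have "0 \<le> exp (2 * L * t) * (2 * (d t \<bullet> d' t) + 2 * L * (d t \<bullet> d t))" if "t \<in> {0..T}" for t
    using le[OF that] by (intro mult_nonneg_nonneg) (auto simp: abs_le_iff)
  then have "exp (2 * L * 0) * (d 0 \<bullet> d 0) \<le> exp (2 * L * T) * (d T \<bullet> d T)"
    by (intro nondecreasing_within[OF T de])
  then have "norm (d 0)^2 \<le> exp (2 * L * T) * norm (d T)^2"
    by (simp add: dot_square_norm)
  from sq[OF this] show "norm (x 0 - y 0) \<le> exp (L * T) * norm (x T - y T)"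
    by (simp add: d_def)
qed

lemma lipschitz_ode_exists:
  fixes F :: "real \<Rightarrow> 'a::euclidean_space \<Rightarrow> 'a"
  assumes cont: "continuous_on ({0..} \<times> UNIV) (\<lambda>(t, x). F t x)"
    and L: "L > 0"
    and lip: "\<And>t x y. 0 \<le> t \<Longrightarrow> norm (F t x - F t y) \<le> L * norm (x - y)"
    and bd: "\<And>t. 0 \<le> t \<Longrightarrow> norm (F t 0) \<le> m"
  obtains x where "x 0 = \<xi>"
    "\<And>t. 0 \<le> t \<Longrightarrow> (x has_vector_derivative F t (x t)) (at t within {0..})"
proof -
  \<comment> \<open>Weighting by \<open>w\<close> makes the Picard operator a contraction with factor \<open>1/2\<close> on
    the whole half-line; negative times, which \<open>bcontfun\<close> requires, are clamped to \<open>0\<close> by \<open>p\<close>.\<close>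
  define w where "w t = exp (2 * L * t)" for t
  \<comment> \<open>The unknown \<open>u\<close> stands for the solution divided by the weight, so
    \<open>g u\<close> is the right-hand side along \<open>w s *\<^sub>R u s\<close>.\<close>
  define g where "g u s = F s (w s *\<^sub>R u s)" for u s
  have wpos: "0 < w t" for t by (simp add: w_def)
  have m: "0 \<le> m" using bd[of 0] norm_ge_zero order_trans by blast
  have gcont: "continuous_on {0..} (g u)" if "continuous_on UNIV u" for u
  proof -
    have "continuous_on {0..} (\<lambda>s. (s, w s *\<^sub>R u s))"
      unfolding w_def by (intro continuous_intros continuous_on_subset[OF that]) auto
    from continuous_on_compose2[OF cont this] show ?thesis
      by (auto simp: g_def)
  qed
  have gint: "g u integrable_on {0..t}" if "continuous_on UNIV u" for u t
    by (rule integrable_continuous_real) (rule continuous_on_subset[OF gcont[OF that]], auto)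
  have wint: "(w has_integral (w t - 1) / (2 * L)) {0..t}" if "0 \<le> t" for t
  proof -
    have "(w has_integral (w t / (2 * L) - w 0 / (2 * L))) {0..t}"
      by (rule fundamental_theorem_of_calculus[OF that])
        (use L in \<open>auto simp: w_def simp flip: has_real_derivative_iff_has_vector_derivative
          intro!: derivative_eq_intros\<close>)
    then show ?thesis by (simp add: w_def diff_divide_distrib)
  qed
  \<comment> \<open>The rate \<open>2 * L\<close> in \<open>w\<close> pays off here: integrating
    \<open>w\<close> gains the factor \<open>1 / (2 * L)\<close>. With \<open>c = m + L * b\<close>
    this shows that the Picard operator preserves boundedness, and with
    \<open>c = L * dist u v\<close> it gives the contraction factor 1/2.\<close>
  have weight: "norm (integral {0..t} h) / w t \<le> c / (2 * L)"
    if "0 \<le> t" "0 \<le> c" "h integrable_on {0..t}"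
      and "\<And>s. s \<in> {0..t} \<Longrightarrow> norm (h s) \<le> c * w s" for h :: "real \<Rightarrow> 'a" and c t
  proof -
    have I: "((\<lambda>s. c * w s) has_integral c * ((w t - 1) / (2 * L))) {0..t}"
      by (rule has_integral_mult_right[OF wint[OF that(1)]])
    have "norm (integral {0..t} h) \<le> integral {0..t} (\<lambda>s. c * w s)"
      by (rule Henstock_Kurzweil_Integration.integral_norm_bound_integral)
        (use that I in \<open>auto simp: has_integral_iff\<close>)
    also have "\<dots> = c * ((w t - 1) / (2 * L))" using I by (rule integral_unique)
    also have "\<dots> \<le> c * (w t / (2 * L))"
      using L that by (intro mult_left_mono divide_right_mono) auto
    finally show ?thesis using wpos[of t] by (simp add: field_simps)
  qed
  define p where "p t = max 0 t" for t :: real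
  define Q where "Q u t = (\<xi> + integral {0..p t} (g u)) /\<^sub>R w (p t)" for u t
  have Icont: "continuous_on {0..} (\<lambda>t. integral {0..t} (g u))" if u: "continuous_on UNIV u" for u
    unfolding continuous_on_eq_continuous_within
  proof
    fix t :: real assume t: "t \<in> {0..}"
    show "continuous (at t within {0..}) (\<lambda>t. integral {0..t} (g u))"
      by (rule has_vector_derivative_continuous, rule has_vector_derivative_within_atLeastI,
          rule integral_has_vector_derivative)
        (use t in \<open>auto intro: continuous_on_subset[OF gcont[OF u]]\<close>)
  qed
  have QC: "Q u \<in> bcontfun" if u: "u \<in> bcontfun" for u
  proof -
    have uc: "continuous_on UNIV u" using u by (simp add: bcontfun_def)
    obtain b where b: "\<And>s. norm (u s) \<le> b"
      using u by (force simp: bcontfun_def bounded_iff)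
    have b0: "0 \<le> b" using b norm_ge_zero order_trans by blast
    have "continuous_on UNIV (\<lambda>t. integral {0..p t} (g u))"
      by (rule continuous_on_compose2[OF Icont[OF uc]])
        (auto simp: p_def intro!: continuous_intros)
    then have "continuous_on UNIV (Q u)"
      unfolding Q_def using wpos
      by (auto simp: w_def p_def intro!: continuous_intros)
    moreover have "norm (Q u t) \<le> norm \<xi> + (m + L * b) / (2 * L)" for t
    proof -
      have "norm (g u s) \<le> (m + L * b) * w s" if s: "s \<in> {0..p t}" for s
      proof -
        have "norm (g u s) \<le> norm (F s 0) + norm (F s (w s *\<^sub>R u s) - F s 0)"
          unfolding g_def by norm
        also have "\<dots> \<le> m + L * norm (w s *\<^sub>R u s - 0)"
          using s by (intro add_mono bd lip) auto
        also have "\<dots> \<le> m * w s + L * (w s * b)"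
        proof (rule add_mono)
          have "1 \<le> w s" using s L by (simp add: w_def)
          then show "m \<le> m * w s" using m by (simp add: mult_le_cancel_left1)
        qed (use b[of s] L wpos[of s] in simp)
        finally show ?thesis by (simp add: algebra_simps)
      qed
      from weight[OF _ _ gint[OF uc] this]
      have I: "norm (integral {0..p t} (g u)) / w (p t) \<le> (m + L * b) / (2 * L)"
        using m L b0 by (auto simp: p_def)
      have "1 \<le> w (p t)" using L by (simp add: w_def p_def)
      then have "norm \<xi> / w (p t) \<le> norm \<xi>"
        by (simp add: divide_le_eq mult_le_cancel_left1)
      moreover have "norm (Q u t) \<le> norm \<xi> / w (p t) + norm (integral {0..p t} (g u)) / w (p t)"
        using wpos[of "p t"] norm_triangle_ineq[of \<xi> "integral {0..p t} (g u)"]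
        by (simp add: Q_def divide_simps flip: add_divide_distrib)
      ultimately show ?thesis using I by linarith
    qed
    ultimately show ?thesis by (rule bcontfun_normI)
  qed
  \<comment> \<open>The operator is lifted to the complete space of bounded continuous functions,
    where Banach's fixed point theorem applies.\<close>
  define QQ where "QQ u = Bcontfun (Q (apply_bcontfun u))" for u
  have QQ: "apply_bcontfun (QQ u) = Q (apply_bcontfun u)" for u
    unfolding QQ_def by (rule Bcontfun_inverse) (rule QC, rule apply_bcontfun)
  have "dist (QQ u) (QQ v) \<le> 1/2 * dist u v" for u v
  proof (rule dist_bound)
    fix t
    have uc: "continuous_on UNIV (apply_bcontfun u)" for u :: "real \<Rightarrow>\<^sub>C 'a" by simp
    have "norm (g u s - g v s) \<le> (L * dist u v) * w s" if s: "s \<in> {0..p t}" for s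
    proof -
      have "norm (g u s - g v s) \<le> L * norm (w s *\<^sub>R u s - w s *\<^sub>R v s)"
        unfolding g_def using s by (intro lip) auto
      also have "\<dots> = L * (w s * dist (u s) (v s))"
        using wpos[of s] by (simp add: dist_norm flip: scaleR_diff_right)
      also have "\<dots> \<le> L * (w s * dist u v)"
        using L wpos[of s] dist_bounded[of u s v] by (intro mult_left_mono) auto
      finally show ?thesis by (simp add: algebra_simps)
    qed
    from weight[OF _ _ integrable_diff[OF gint[OF uc] gint[OF uc]] this]
    have "norm (integral {0..p t} (\<lambda>s. g u s - g v s)) / w (p t) \<le> L * dist u v / (2 * L)"
      using L by (auto simp: p_def)
    moreover have "dist (Q u t) (Q v t) = norm (integral {0..p t} (\<lambda>s. g u s - g v s)) / w (p t)"
    proof -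
      have "Q u t - Q v t = integral {0..p t} (\<lambda>s. g u s - g v s) /\<^sub>R w (p t)"
        unfolding Q_def Henstock_Kurzweil_Integration.integral_diff[OF gint[OF uc] gint[OF uc]]
        by (simp flip: scaleR_diff_right)
      then show ?thesis using wpos[of "p t"] by (simp add: dist_norm divide_inverse mult.commute)
    qed
    ultimately show "dist (QQ u t) (QQ v t) \<le> 1/2 * dist u v"
      using L by (simp add: QQ)
  qed
  then obtain u where "QQ u = u"
    using banach_fix_type[of "1/2" QQ] by auto
  then have u: "Q u = apply_bcontfun u" using QQ by metis
  \<comment> \<open>Defined as an integral, \<open>x\<close> can be differentiated at once; the
    fixed point equation then identifies it with \<open>w t *\<^sub>R u t\<close>, which turns
    \<open>g u t\<close> into \<open>F t (x t)\<close>.\<close>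
  define x where "x t = \<xi> + integral {0..t} (g u)" for t
  have xu: "x t = w t *\<^sub>R u t" if "0 \<le> t" for t
  proof -
    have "apply_bcontfun u t = Q (apply_bcontfun u) t" by (simp add: u)
    also have "\<dots> = x t /\<^sub>R w t"
      using that by (simp add: Q_def p_def x_def max_def)
    finally show ?thesis using wpos[of t] by simp
  qed
  show ?thesis
  proof
    show "x 0 = \<xi>" by (simp add: x_def)
  next
    fix t :: real assume t: "0 \<le> t"
    have "((\<lambda>t. integral {0..t} (g u)) has_vector_derivative g u t) (at t within {0..})"
      by (rule has_vector_derivative_within_atLeastI, rule integral_has_vector_derivative)
        (use t in \<open>auto intro: continuous_on_subset[OF gcont]\<close>)
    then show "(x has_vector_derivative F t (x t)) (at t within {0..})"
      unfolding x_def[abs_def] using xu[OF t]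
      by (auto simp: g_def x_def intro!: derivative_eq_intros)
  qed
qed

text \<open>Comparing \<open>f s y\<close> with \<open>f t x\<close> through \<open>f s x\<close>
  splits the error into a Lipschitz part, whose constant is continuous in time, and a part in time
  alone. It serves both for flows and for their inverses.\<close>

lemma continuous_on_Times_expI:
  fixes f :: "real \<Rightarrow> 'a::real_normed_vector \<Rightarrow> 'b::real_normed_vector"
  assumes cont: "\<And>x. continuous_on T (\<lambda>t. f t x)"
    and lip: "\<And>t x y. t \<in> T \<Longrightarrow> norm (f t x - f t y) \<le> exp (L * t) * norm (x - y)"
  shows "continuous_on (T \<times> UNIV) (\<lambda>(t, x). f t x)"
  unfolding continuous_on_def
proof
  fix q :: "real \<times> 'a" assume q: "q \<in> T \<times> UNIV"
  obtain t x where tx: "q = (t, x)" by (cases q)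
  define g where "g p = exp (L * fst p) * norm (snd p - x) + norm (f (fst p) x - f t x)" for p
  have "continuous_on (T \<times> UNIV) g"
    unfolding g_def by (intro continuous_intros continuous_on_compose2[OF cont]) auto
  then have "(g \<longlongrightarrow> g q) (at q within T \<times> UNIV)"
    using q unfolding continuous_on_def by blast
  then have "(g \<longlongrightarrow> 0) (at q within T \<times> UNIV)"
    by (simp add: g_def tx)
  moreover have "norm (f s y - f t x) \<le> g (s, y)" if "s \<in> T" for s y
    using lip[OF that, of y x] norm_triangle_ineq[of "f s y - f s x" "f s x - f t x"]
    by (simp add: g_def)
  then have "\<forall>\<^sub>F p in at q within T \<times> UNIV. norm ((\<lambda>(s, y). f s y) p - f t x) \<le> g p"
    unfolding eventually_at_filter by (intro always_eventually) auto
  ultimately show "((\<lambda>(s, y). f s y) \<longlongrightarrow> (\<lambda>(s, y). f s y) q) (at q within T \<times> UNIV)"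
    unfolding tx by (auto intro: LIM_zero_cancel Lim_null_comparison)
qed

section \<open>Flows from time 0 and their inverses\<close>

text \<open>All trajectories start at time 0, so no group law is involved for these nonautonomous
  equations. Bijectivity of \<open>\<Phi> t\<close> says that each state at time \<open>t\<close> is
  reached from exactly one initial value.\<close>

definition is_flow ::
    "(real \<Rightarrow> real ^ 'n \<Rightarrow> real ^ 'n) \<Rightarrow> (real \<Rightarrow> real ^ 'n \<Rightarrow> real ^ 'n) \<Rightarrow> bool" where
  "is_flow F \<Phi> \<longleftrightarrow>
     (\<forall>\<xi>. \<Phi> 0 \<xi> = \<xi> \<and> ode_solution {0..} F (\<lambda>t. \<Phi> t \<xi>)) \<and>
     (\<forall>x t. ode_solution {0..} F x \<longrightarrow> 0 \<le> t \<longrightarrow> x t = \<Phi> t (x 0)) \<and>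
     (\<forall>t\<ge>0. bij (\<Phi> t)) \<and>
     continuous_on ({0..} \<times> UNIV) (\<lambda>(t, u). \<Phi> t u) \<and>
     continuous_on ({0..} \<times> UNIV) (\<lambda>(t, u). inv (\<Phi> t) u)"

lemma ode_solution_subset:
  "ode_solution J F x \<Longrightarrow> I \<subseteq> J \<Longrightarrow> t \<in> I \<Longrightarrow>
    (x has_vector_derivative F t (x t)) (at t within I)"
  unfolding ode_solution_def by (blast intro: has_vector_derivative_within_subset)

lemma ode_solution_cong:
  assumes "ode_solution J F x" "\<And>t. t \<in> J \<Longrightarrow> y t = x t"
  shows "ode_solution J F y"
  using assms unfolding ode_solution_def
  by (auto intro: has_vector_derivative_transform[of _ J y x])

lemma ode_solution_continuous_on: "ode_solution J F x \<Longrightarrow> continuous_on J x"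
  unfolding ode_solution_def continuous_on_eq_continuous_within
  by (blast intro: has_vector_derivative_continuous)

text \<open>The forward Gronwall estimate gives uniqueness and a Lipschitz bound in the initial
  value; the backward one gives injectivity and the same bound for the inverse. Surjectivity comes
  from solving backwards in time.\<close>

lemma lipschitz_ode_flow:
  fixes F :: "real \<Rightarrow> real ^ 'n \<Rightarrow> real ^ 'n"
  assumes cont: "continuous_on ({0..} \<times> UNIV) (\<lambda>(t, x). F t x)"
    and L: "L > 0"
    and lip: "\<And>t x y. 0 \<le> t \<Longrightarrow> norm (F t x - F t y) \<le> L * norm (x - y)"
    and bd: "\<And>t. 0 \<le> t \<Longrightarrow> norm (F t 0) \<le> m"
  obtains \<Phi> where "is_flow F \<Phi>"
proof -
  have "\<exists>x. x 0 = \<xi> \<and> ode_solution {0..} F x" for \<xi>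
    using lipschitz_ode_exists[OF cont L lip bd] unfolding ode_solution_def by (metis atLeast_iff)
  then obtain x where x0: "\<And>\<xi>. x \<xi> 0 = \<xi>" and x: "\<And>\<xi>. ode_solution {0..} F (x \<xi>)"
    by metis
  define \<Phi> where "\<Phi> t \<xi> = x \<xi> t" for t \<xi>
  have \<Phi>0: "\<Phi> 0 \<xi> = \<xi>" and \<Phi>: "ode_solution {0..} F (\<lambda>t. \<Phi> t \<xi>)" for \<xi>
    using x0 x by (simp_all add: \<Phi>_def)
  have dep: "norm (y t - z t) \<le> exp (L * t) * norm (y 0 - z 0)"
    if "ode_solution {0..} F y" "ode_solution {0..} F z" "0 \<le> t" for y z t
    by (rule lipschitz_ode_dependence(1)[of t F L, OF _ lip])
      (use that ode_solution_subset[of "{0..}" F _ "{0..t}"] in auto)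
  have dep': "norm (\<xi> - \<eta>) \<le> exp (L * t) * norm (\<Phi> t \<xi> - \<Phi> t \<eta>)" if "0 \<le> t" for t \<xi> \<eta>
    using lipschitz_ode_dependence(2)[of t F L "\<lambda>t. \<Phi> t \<xi>" "\<lambda>t. \<Phi> t \<eta>", OF _ lip]
      that ode_solution_subset[OF \<Phi>, of "{0..t}"] by (auto simp: \<Phi>0)
  have inj: "inj (\<Phi> t)" if "0 \<le> t" for t
  proof (rule injI)
    show "\<xi> = \<eta>" if "\<Phi> t \<xi> = \<Phi> t \<eta>" for \<xi> \<eta>
      using dep'[OF \<open>0 \<le> t\<close>, of \<xi> \<eta>] that by simp
  qed
  have surj: "surj (\<Phi> t)" if t: "0 \<le> t" for t
  proof -
    have "v \<in> range (\<Phi> t)" for v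
    proof -
      \<comment> \<open>Solve the time-reversed equation from \<open>v\<close>; freezing the time at \<open>0\<close> makes it global.\<close>
      define r where "r s = max 0 (t - s)" for s
      have rcont: "continuous_on ({0..} \<times> UNIV) (\<lambda>(s, x). - F (r s) x)"
        unfolding split_beta r_def
        by (intro continuous_on_minus continuous_on_compose2[OF cont[unfolded split_beta],
              where f = "\<lambda>p. (max 0 (t - fst p), snd p)", simplified] continuous_intros) auto
      have rlip: "norm (- F (r s) x - - F (r s) y) \<le> L * norm (x - y)" for s x y
        using lip[of "r s" y x] by (simp add: r_def norm_minus_commute)
      have rbd: "norm (- F (r s) 0) \<le> m" for s
        using bd[of "r s"] by (simp add: r_def)
      obtain w where w0: "w 0 = v"
        and w: "\<And>s. 0 \<le> s \<Longrightarrow> (w has_vector_derivative - F (r s) (w s)) (at s within {0..})"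
        using lipschitz_ode_exists[OF rcont L rlip rbd] by metis
      define y where "y s = w (t - s)" for s
      have y: "(y has_vector_derivative F s (y s)) (at s within {0..t})" if s: "s \<in> {0..t}" for s
      proof -
        have "((\<lambda>s. t - s) has_vector_derivative - 1) (at s within {0..t})"
          by (auto intro!: derivative_eq_intros)
        moreover have "(w has_vector_derivative - F (r (t - s)) (w (t - s)))
            (at (t - s) within (\<lambda>s. t - s) ` {0..t})"
          by (rule has_vector_derivative_within_subset[OF w]) (use s in auto)
        ultimately have "(w \<circ> (\<lambda>s. t - s) has_vector_derivative
            - 1 *\<^sub>R - F (r (t - s)) (w (t - s))) (at s within {0..t})"
          by (rule vector_diff_chain_within)
        then show ?thesis using s by (simp add: y_def[abs_def] r_def comp_def)
      qed
      \<comment> \<open>Since \<open>y\<close> is known to be a solution only on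
        \<open>{0..t}\<close>, it is compared with the trajectory through \<open>y 0\<close> on that
        interval.\<close>
      have "norm (\<Phi> t (y 0) - y t) \<le> exp (L * t) * norm (\<Phi> 0 (y 0) - y 0)"
        by (rule lipschitz_ode_dependence(1)[of t F L, OF _ lip])
          (use t y ode_solution_subset[OF \<Phi>, of "{0..t}"] in auto)
      then have "\<Phi> t (y 0) = v" by (simp add: \<Phi>0 y_def w0)
      then show ?thesis by blast
    qed
    then show ?thesis by auto
  qed
  have bij: "bij (\<Phi> t)" if "0 \<le> t" for t
    using inj[OF that] surj[OF that] by (simp add: bij_def)
  have \<Phi>inv: "\<Phi> t (inv (\<Phi> t) v) = v" if "0 \<le> t" for t v
    using surj[OF that] by (simp add: surj_f_inv_f)
  have \<Phi>cont: "continuous_on {0..} (\<lambda>t. \<Phi> t \<xi>)" for \<xi>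
    by (rule ode_solution_continuous_on[OF \<Phi>])
  have invlip: "norm (inv (\<Phi> t) u - inv (\<Phi> t) v) \<le> exp (L * t) * norm (u - v)" if "0 \<le> t" for t u v
    using dep'[OF that, of "inv (\<Phi> t) u" "inv (\<Phi> t) v"] by (simp add: \<Phi>inv that)
  have invcont: "continuous_on {0..} (\<lambda>t. inv (\<Phi> t) v)" for v
    unfolding continuous_on_def
  proof
    fix s :: real assume s: "s \<in> {0..}"
    \<comment> \<open>The backward estimate at time \<open>t\<close>, applied to
      \<open>inv (\<Phi> t) v\<close> and \<open>inv (\<Phi> s) v\<close>, gives this majorant. It
      involves only the single trajectory from \<open>inv (\<Phi> s) v\<close>, which passes through
      \<open>v\<close> at time \<open>s\<close>.\<close>
    define g where "g t = exp (L * t) * norm (v - \<Phi> t (inv (\<Phi> s) v))" for t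
    have "continuous_on {0..} g"
      unfolding g_def by (intro continuous_intros \<Phi>cont)
    then have "(g \<longlongrightarrow> g s) (at s within {0..})"
      using s by (simp add: continuous_on_def)
    then have "(g \<longlongrightarrow> 0) (at s within {0..})"
      using s by (simp add: g_def \<Phi>inv)
    moreover have "norm (inv (\<Phi> t) v - inv (\<Phi> s) v) \<le> g t" if "0 \<le> t" for t
      using dep'[OF that, of "inv (\<Phi> t) v" "inv (\<Phi> s) v"] by (simp add: g_def \<Phi>inv that)
    then have "\<forall>\<^sub>F t in at s within {0..}. norm (inv (\<Phi> t) v - inv (\<Phi> s) v) \<le> g t"
      by (auto simp: eventually_at_filter)
    ultimately show "((\<lambda>t. inv (\<Phi> t) v) \<longlongrightarrow> inv (\<Phi> s) v) (at s within {0..})"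
      by (auto intro: LIM_zero_cancel Lim_null_comparison)
  qed
  have "is_flow F \<Phi>"
    unfolding is_flow_def
  proof (intro conjI allI impI)
    show "\<Phi> 0 \<xi> = \<xi>" "ode_solution {0..} F (\<lambda>t. \<Phi> t \<xi>)" for \<xi>
      by (fact \<Phi>0, fact \<Phi>)
    show "y t = \<Phi> t (y 0)" if "ode_solution {0..} F y" "0 \<le> t" for y t
      using dep[OF that(1) \<Phi>[of "y 0"] that(2)] by (simp add: \<Phi>0)
    show "bij (\<Phi> t)" if "0 \<le> t" for t using bij[OF that] .
    show "continuous_on ({0..} \<times> UNIV) (\<lambda>(t, u). \<Phi> t u)"
      by (rule continuous_on_Times_expI[where L = L, OF \<Phi>cont])
        (use dep[OF \<Phi> \<Phi>] in \<open>auto simp: \<Phi>0\<close>)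
    show "continuous_on ({0..} \<times> UNIV) (\<lambda>(t, u). inv (\<Phi> t) u)"
      by (rule continuous_on_Times_expI[where L = L, OF invcont]) (use invlip in auto)
  qed
  then show ?thesis by (rule that)
qed

lemma is_flowD:
  assumes "is_flow F \<Phi>"
  shows "\<Phi> 0 \<xi> = \<xi>" "ode_solution {0..} F (\<lambda>t. \<Phi> t \<xi>)"
    "ode_solution {0..} F x \<Longrightarrow> 0 \<le> t \<Longrightarrow> x t = \<Phi> t (x 0)"
    "0 \<le> t \<Longrightarrow> bij (\<Phi> t)"
    "0 \<le> t \<Longrightarrow> \<Phi> t (inv (\<Phi> t) u) = u" "0 \<le> t \<Longrightarrow> inv (\<Phi> t) (\<Phi> t u) = u"
    "continuous_on ({0..} \<times> UNIV) (\<lambda>(t, u). \<Phi> t u)"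
    "continuous_on ({0..} \<times> UNIV) (\<lambda>(t, u). inv (\<Phi> t) u)"
  using assms unfolding is_flow_def
  by (auto simp: bij_is_surj surj_f_inv_f bij_is_inj inv_f_f)

section \<open>Conjugacy of two flows at bounded distance\<close>

lemma is_flow_continuous_conjugacy:
  assumes "is_flow F \<Phi>" "is_flow F' \<Psi>"
  shows "continuous_on ({0..} \<times> UNIV) (\<lambda>(t, u). \<Psi> t (inv (\<Phi> t) u))"
proof -
  have "continuous_on ({0..} \<times> UNIV) (\<lambda>p. (fst p, inv (\<Phi> (fst p)) (snd p)))"
    using is_flowD(8)[OF assms(1)] unfolding split_beta by (intro continuous_intros)
  from continuous_on_compose2[OF is_flowD(7)[OF assms(2)] this]
  show ?thesis by (simp add: split_beta image_subset_iff)
qed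

text \<open>Pulling \<open>u\<close> back to its initial value by one flow and pushing it forward by
  the other sends trajectories to trajectories, and the displacement of \<open>u\<close> becomes the
  distance of two trajectories with a common start. The formula for \<open>H\<close> is a hypothesis
  at nonnegative times only, so that the lemma also covers the inverse maps with the flows
  exchanged.\<close>

lemma flow_conjugacy:
  fixes nrm :: "real ^ 'n \<Rightarrow> real"
  assumes \<Phi>: "is_flow F \<Phi>" and \<Psi>: "is_flow F' \<Psi>"
    and B: "\<And>t \<xi>. 0 \<le> t \<Longrightarrow> nrm (\<Psi> t \<xi> - \<Phi> t \<xi>) \<le> B"
    and H: "\<And>t u. 0 \<le> t \<Longrightarrow> H t u = \<Psi> t (inv (\<Phi> t) u)"
  shows "maps_solutions {0..} F F' H" "near_identity_homeos nrm {0..} H"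
proof -
  show "maps_solutions {0..} F F' H"
    unfolding maps_solutions_def
  proof (intro allI impI)
    fix x assume x: "ode_solution {0..} F x"
    have "H t (x t) = \<Psi> t (x 0)" if "t \<in> {0..}" for t
    proof -
      have t: "0 \<le> t" using that by simp
      show ?thesis
        unfolding H[OF t] is_flowD(3)[OF \<Phi> x t] is_flowD(6)[OF \<Phi> t] ..
    qed
    then show "ode_solution {0..} F' (\<lambda>t. H t (x t))"
      by (rule ode_solution_cong[OF is_flowD(2)[OF \<Psi>]])
  qed
  show "near_identity_homeos nrm {0..} H"
    unfolding near_identity_homeos_def
  proof (intro conjI exI ballI allI)
    fix t :: real and u assume "t \<in> {0..}"
    then have t: "0 \<le> t" by simp
    show "nrm (H t u - u) \<le> B"
      using B[OF t, of "inv (\<Phi> t) u"] unfolding H[OF t] is_flowD(5)[OF \<Phi> t] .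
  next
    fix t :: real assume t: "t \<in> {0..}"
    have sec: "continuous_on UNIV (g t)"
      if "continuous_on ({0..} \<times> UNIV) (\<lambda>(t, u). g t u)" for g :: "real \<Rightarrow> real^'n \<Rightarrow> real^'n"
    proof -
      have "continuous_on UNIV (\<lambda>u :: real^'n. (t, u))" by (intro continuous_intros)
      from continuous_on_compose2[OF that this] show ?thesis
        using t by (simp add: image_subset_iff)
    qed
    show "homeomorphism UNIV UNIV (H t) (\<lambda>u. \<Phi> t (inv (\<Psi> t) u))"
    proof -
      have t0: "0 \<le> t" using t by simp
      have Ht: "H t = (\<lambda>u. \<Psi> t (inv (\<Phi> t) u))" using H[OF t0] by blast
      show ?thesis
        unfolding Ht
        by (rule homeomorphismI[OF sec[OF is_flow_continuous_conjugacy[OF \<Phi> \<Psi>]]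
              sec[OF is_flow_continuous_conjugacy[OF \<Psi> \<Phi>]]])
          (simp_all add: is_flowD(5,6)[OF \<Phi> t0] is_flowD(5,6)[OF \<Psi> t0])
    qed
  next
    show "continuous_on ({0..} \<times> UNIV) (\<lambda>(t, u). H t u)"
      using is_flow_continuous_conjugacy[OF \<Phi> \<Psi>]
      by (rule iffD1[OF continuous_on_cong[OF refl], rotated]) (auto simp: H)
  qed
qed

text \<open>The situation is symmetric in the two flows because \<open>nrm\<close> is even, so
  \<open>flow_conjugacy\<close> applies in both directions.\<close>

lemma bounded_distance_flows_equivalent:
  assumes nrm: "norm_fun nrm" and \<Phi>: "is_flow F \<Phi>" and \<Psi>: "is_flow F' \<Psi>"
    and B: "\<And>t \<xi>. 0 \<le> t \<Longrightarrow> nrm (\<Psi> t \<xi> - \<Phi> t \<xi>) \<le> B"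
  shows "continuously_topologically_equivalent nrm {0..} F F'"
proof -
  define H where "H t u = \<Psi> t (inv (\<Phi> t) u)" for t u
  have "nrm (- x) = nrm x" for x
    using nrm unfolding norm_fun_def by (metis abs_minus_cancel abs_one mult_1 scaleR_minus1_left)
  then have B': "nrm (\<Phi> t \<xi> - \<Psi> t \<xi>) \<le> B" if "0 \<le> t" for t \<xi>
    using B[OF that, of \<xi>] by (metis minus_diff_eq)
  have invH: "inv (H t) u = \<Phi> t (inv (\<Psi> t) u)" if "0 \<le> t" for t u
    by (rule inv_equality[THEN fun_cong])
      (simp_all add: H_def is_flowD(5,6)[OF \<Phi> that] is_flowD(5,6)[OF \<Psi> that])
  have "maps_solutions {0..} F F' H" "near_identity_homeos nrm {0..} H"
    by (rule flow_conjugacy[OF \<Phi> \<Psi>], auto intro: B simp: H_def)+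
  moreover have "maps_solutions {0..} F' F (\<lambda>t. inv (H t))"
      "near_identity_homeos nrm {0..} (\<lambda>t. inv (H t))"
    by (rule flow_conjugacy[OF \<Psi> \<Phi>], auto intro: B' simp: invH)+
  ultimately show ?thesis unfolding continuously_topologically_equivalent_def by blast
qed

section \<open>Variation of constants and the distance between the two flows\<close>

lemma matrix_inv_invertible:
  fixes A :: "real ^ 'n ^ 'n"
  assumes "invertible A"
  shows "A ** matrix_inv A = mat 1" "matrix_inv A ** A = mat 1"
  using someI_ex[OF assms[unfolded invertible_def]] by (simp_all add: matrix_inv_def)

text \<open>Variation of constants is obtained by uniqueness: the explicit candidate
  \<open>e\<close> and the perturbed trajectory solve the same linear equation with forcing
  \<open>f s (\<Psi> s \<xi>)\<close>. The decaying kernel then has integral at most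
  \<open>c / \<alpha>\<close>, whatever \<open>t\<close> is.\<close>

lemma perturbed_flow_bounded_distance:
  fixes A :: "real \<Rightarrow> real ^ 'n ^ 'n"
  assumes f: "continuous_on ({0..} \<times> UNIV) (\<lambda>(t, y). f t y)"
    and L: "\<And>t x. 0 \<le> t \<Longrightarrow> norm (A t *v x) \<le> L * norm x"
    and X: "transition_matrix {0..} A X"
    and \<Phi>: "is_flow (\<lambda>t x. A t *v x) \<Phi>"
    and \<Psi>: "is_flow (\<lambda>t y. A t *v y + f t y) \<Psi>"
    and "\<alpha> > 0"
    and decay: "\<And>s t y. 0 \<le> s \<Longrightarrow> s \<le> t \<Longrightarrow> norm (X t s *v f s y) \<le> c * exp (- \<alpha> * (t - s))"
    and t: "0 \<le> t"
  shows "norm (\<Psi> t \<xi> - \<Phi> t \<xi>) \<le> c / \<alpha>"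
proof -
  obtain Y where Y: "fundamental_matrix {0..} A Y"
    and XY: "\<And>t s. 0 \<le> t \<Longrightarrow> 0 \<le> s \<Longrightarrow> X t s = Y t ** matrix_inv (Y s)"
    using X by (auto simp: transition_matrix_def)
  have Y_inv: "invertible (Y s)" if "0 \<le> s" for s
    using Y that by (simp add: fundamental_matrix_def)
  \<comment> \<open>Normalised to the identity at time 0, the fundamental matrix represents the
    linear flow \<open>\<Phi>\<close>.\<close>
  define W where "W s = Y s ** matrix_inv (Y 0)" for s
  have W0: "W 0 = mat 1"
    by (simp add: W_def matrix_inv_invertible Y_inv)
  have dW: "(W has_vector_derivative A s ** W s) (at s within {0..})" if "0 \<le> s" for s
  proof -
    have "(Y has_vector_derivative A s ** Y s) (at s within {0..})"
      using Y that by (simp add: fundamental_matrix_def)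
    from bounded_linear.has_vector_derivative[OF bounded_linear_matrix_mult_right this]
    show ?thesis by (simp add: W_def[abs_def] matrix_mul_assoc)
  qed
  have dWv: "((\<lambda>s. W s *v v s) has_vector_derivative W s *v v' + A s *v (W s *v v s)) (at s within {0..})"
    if "0 \<le> s" "(v has_vector_derivative v') (at s within {0..})" for s v v'
    using bounded_bilinear.has_vector_derivative[OF bounded_bilinear_matrix_vector dW[OF that(1)] that(2)]
    by (simp add: matrix_vector_mul_assoc)
  have \<Phi>W: "\<Phi> s \<eta> = W s *v \<eta>" if "0 \<le> s" for s \<eta>
  proof -
    have "ode_solution {0..} (\<lambda>t x. A t *v x) (\<lambda>s. W s *v \<eta>)"
      using dWv[OF _ has_vector_derivative_const] by (auto simp: ode_solution_def)
    from is_flowD(3)[OF \<Phi> this that] show ?thesis by (simp add: W0)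
  qed
  \<comment> \<open>The transition matrix factors through time 0, with \<open>inv (\<Phi> s)\<close>
    acting as the inverse of \<open>W s\<close>.\<close>
  have XW: "X r s *v v = W r *v inv (\<Phi> s) v" if "0 \<le> s" "s \<le> r" for r s v
  proof -
    have v: "W s *v inv (\<Phi> s) v = v"
      using is_flowD(5)[OF \<Phi> that(1)] \<Phi>W[OF that(1)] by simp
    have "X r s ** W s = W r"
      using that by (simp add: XY W_def matrix_mul_assoc[symmetric])
        (simp add: matrix_mul_assoc matrix_inv_invertible Y_inv flip: matrix_mul_assoc[of "matrix_inv (Y s)"])
    then have "W r *v inv (\<Phi> s) v = X r s *v (W s *v inv (\<Phi> s) v)"
      by (simp add: matrix_vector_mul_assoc)
    then show ?thesis by (simp add: v)
  qed
  \<comment> \<open>The forcing is pulled back to time 0, so the integrand does not depend on the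
    end time; applying \<open>W t\<close> afterwards restores the kernel
    \<open>X t s\<close>.\<close>
  define h where "h s = inv (\<Phi> s) (f s (\<Psi> s \<xi>))" for s
  have \<Psi>sol: "ode_solution {0..} (\<lambda>t y. A t *v y + f t y) (\<lambda>s. \<Psi> s \<xi>)"
    by (rule is_flowD(2)[OF \<Psi>])
  have fcont: "continuous_on {0..} (\<lambda>s. f s (\<Psi> s \<xi>))"
    using continuous_on_compose2[OF f continuous_on_Pair[OF continuous_on_id
          ode_solution_continuous_on[OF \<Psi>sol]]] by auto
  have hcont: "continuous_on {0..} h"
    unfolding h_def
    using continuous_on_compose2[OF is_flowD(8)[OF \<Phi>] continuous_on_Pair[OF continuous_on_id fcont]]
    by auto
  define I where "I s = integral {0..s} h" for s
  define e where "e s = W s *v (\<xi> + I s)" for s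
  have dI: "(I has_vector_derivative h s) (at s within {0..})" if "0 \<le> s" for s
    unfolding I_def[abs_def]
    by (rule has_vector_derivative_within_atLeastI, rule integral_has_vector_derivative)
      (use that in \<open>auto intro: continuous_on_subset[OF hcont]\<close>)
  have Wh: "W s *v h s = f s (\<Psi> s \<xi>)" if "0 \<le> s" for s
    using is_flowD(5)[OF \<Phi> that] \<Phi>W[OF that] by (simp add: h_def)
  have de: "(e has_vector_derivative A s *v e s + f s (\<Psi> s \<xi>)) (at s within {0..})" if "0 \<le> s" for s
  proof -
    have "((\<lambda>s. \<xi> + I s) has_vector_derivative h s) (at s within {0..})"
      using has_vector_derivative_add[OF has_vector_derivative_const dI[OF that]] by simp
    from dWv[OF that this] show ?thesis
      by (simp add: e_def[abs_def] Wh[OF that] add.commute)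
  qed
  \<comment> \<open>With the trajectory inside \<open>f\<close> held fixed, the forcing depends on
    time alone and cancels in differences, so the bound on \<open>A\<close> is a Lipschitz
    constant.\<close>
  have "norm (\<Psi> t \<xi> - e t) \<le> exp (L * t) * norm (\<Psi> 0 \<xi> - e 0)"
  proof (rule lipschitz_ode_dependence(1)[where F = "\<lambda>s y. A s *v y + f s (\<Psi> s \<xi>)"])
    show "norm (A s *v x + f s (\<Psi> s \<xi>) - (A s *v y + f s (\<Psi> s \<xi>))) \<le> L * norm (x - y)"
      if "s \<in> {0..t}" for s x y
      using L[of s "x - y"] that by (simp add: matrix_vector_mult_diff_distrib)
    show "(e has_vector_derivative A s *v e s + f s (\<Psi> s \<xi>)) (at s within {0..t})"
      if "s \<in> {0..t}" for s
      by (rule has_vector_derivative_within_subset[OF de]) (use that in auto)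
  qed (use t ode_solution_subset[OF \<Psi>sol, of "{0..t}"] in auto)
  also have "\<Psi> 0 \<xi> - e 0 = 0"
    by (simp add: is_flowD(1)[OF \<Psi>] e_def I_def W0)
  finally have "\<Psi> t \<xi> - \<Phi> t \<xi> = W t *v I t"
    by (simp add: e_def \<Phi>W[OF t] matrix_vector_right_distrib)
  also have "\<dots> = integral {0..t} (\<lambda>s. W t *v h s)"
    unfolding I_def
    using integral_linear[OF integrable_continuous_real[OF continuous_on_subset[OF hcont]]
        matrix_vector_mul_bounded_linear, of 0 t "W t"]
    by (simp add: comp_def)
  finally have eq: "\<Psi> t \<xi> - \<Phi> t \<xi> = integral {0..t} (\<lambda>s. W t *v h s)" .
  have E: "((\<lambda>s. c * exp (- \<alpha> * (t - s))) has_integral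
      c / \<alpha> * exp (- \<alpha> * (t - t)) - c / \<alpha> * exp (- \<alpha> * (t - 0))) {0..t}"
    by (rule fundamental_theorem_of_calculus[OF t])
      (use \<open>\<alpha> > 0\<close> in \<open>auto simp flip: has_real_derivative_iff_has_vector_derivative
        intro!: derivative_eq_intros\<close>)
  have "norm (\<Psi> t \<xi> - \<Phi> t \<xi>) \<le> integral {0..t} (\<lambda>s. c * exp (- \<alpha> * (t - s)))"
    unfolding eq
  proof (rule Henstock_Kurzweil_Integration.integral_norm_bound_integral)
    show "(\<lambda>s. W t *v h s) integrable_on {0..t}"
      by (rule integrable_continuous_real,
          rule bounded_linear.continuous_on[OF matrix_vector_mul_bounded_linear],
          rule continuous_on_subset[OF hcont]) auto
    show "norm (W t *v h s) \<le> c * exp (- \<alpha> * (t - s))" if "s \<in> {0..t}" for s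
      using decay[of s t "\<Psi> s \<xi>"] XW[of s t "f s (\<Psi> s \<xi>)"] that by (simp add: h_def)
  qed (use E in \<open>auto simp: has_integral_iff\<close>)
  also have "\<dots> = c / \<alpha> - c / \<alpha> * exp (- \<alpha> * t)"
    using integral_unique[OF E] by simp
  also have "\<dots> \<le> c / \<alpha>"
  proof -
    \<comment> \<open>At \<open>t = s = 0\<close> the exponential is 1, so \<open>c\<close>
      dominates a norm.\<close>
    have "0 \<le> c" using norm_ge_zero[of "X 0 0 *v f 0 0"] decay[of 0 0 0] by (simp del: norm_ge_zero)
    then show ?thesis using \<open>\<alpha> > 0\<close> by simp
  qed
  finally show ?thesis .
qed

section \<open>Comparison of the given norm with the Euclidean one\<close>

text \<open>Expansion in the standard basis bounds \<open>nrm\<close> from above and thereby makes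
  it continuous. Its minimum on the compact unit sphere is then attained and positive, and the
  reciprocal serves as \<open>b\<close>.\<close>

lemma norm_fun_equivalent:
  fixes nrm :: "real ^ 'n \<Rightarrow> real"
  assumes nrm: "norm_fun nrm"
  obtains a b where "a > 0" "\<And>x. nrm x \<le> a * norm x" "b > 0" "\<And>x. norm x \<le> b * nrm x"
proof -
  have nn: "0 \<le> nrm x" and zero: "nrm x = 0 \<longleftrightarrow> x = 0" and scale: "nrm (c *\<^sub>R x) = \<bar>c\<bar> * nrm x"
    and tri: "nrm (x + y) \<le> nrm x + nrm y" for x y c
    using nrm by (auto simp: norm_fun_def)
  have nsum: "nrm (sum g S) \<le> (\<Sum>i\<in>S. nrm (g i))" if "finite S" for g :: "'n \<Rightarrow> real^'n" and S
    using that
  proof induction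
    case (insert i S)
    then show ?case using tri[of "g i" "sum g S"] by simp
  qed (simp add: zero[THEN iffD2])
  define a where "a = (\<Sum>i\<in>UNIV. nrm (axis i 1)) + 1"
  have a: "a > 0" unfolding a_def using nn by (simp add: sum_nonneg add_nonneg_pos)
  have upper: "nrm x \<le> a * norm x" for x
  proof -
    have "nrm x = nrm (\<Sum>i\<in>UNIV. x $ i *\<^sub>R axis i 1)"
      using basis_expansion[of x] by (simp add: scalar_mult_eq_scaleR)
    also have "\<dots> \<le> (\<Sum>i\<in>UNIV. \<bar>x $ i\<bar> * nrm (axis i 1))"
      using nsum[of UNIV "\<lambda>i. x $ i *\<^sub>R axis i 1"] by (simp add: scale)
    also have "\<dots> \<le> (\<Sum>i\<in>UNIV. norm x * nrm (axis i 1))"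
      by (intro sum_mono mult_right_mono component_le_norm_cart nn)
    also have "\<dots> \<le> a * norm x"
      by (simp add: a_def algebra_simps sum_distrib_left)
    finally show ?thesis .
  qed
  have lip: "\<bar>nrm x - nrm y\<bar> \<le> a * norm (x - y)" for x y
    using tri[of "x - y" y] tri[of "y - x" x] upper[of "x - y"] upper[of "y - x"]
    by (simp add: norm_minus_commute)
  have "a-lipschitz_on UNIV nrm"
    using lip a by (intro lipschitz_onI) (auto simp: dist_norm)
  then have "continuous_on (sphere 0 1) nrm"
    by (metis continuous_on_subset lipschitz_on_continuous_on subset_UNIV)
  then obtain u where u: "u \<in> sphere 0 1" "\<And>x. x \<in> sphere 0 1 \<Longrightarrow> nrm u \<le> nrm x"
    using continuous_attains_inf[of "sphere (0 :: real^'n) 1" nrm]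
    by (auto simp: sphere_eq_empty)
  have nu: "nrm u > 0" using u(1) nn[of u] zero[of u] by auto
  have "norm x \<le> 1 / nrm u * nrm x" for x
  proof (cases "x = 0")
    case False
    then have "nrm u \<le> nrm ((1 / norm x) *\<^sub>R x)" by (intro u(2)) simp
    then show ?thesis using nu False by (simp add: scale field_simps)
  qed (simp add: nn zero)
  with a upper nu that show ?thesis by (metis zero_less_divide_1_iff)
qed

text \<open>A real supremum dominates its set only if that set is bounded above. Here boundedness
  follows from the equivalence of norms and the Euclidean operator norm.\<close>

lemma op_norm_bound:
  assumes nrm: "norm_fun nrm"
  shows "nrm (A *v x) \<le> op_norm nrm A * nrm x"
proof -
  obtain a b where a: "a > 0" "\<And>x. nrm x \<le> a * norm x" and b: "b > 0" "\<And>x. norm x \<le> b * nrm x"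
    using norm_fun_equivalent[OF nrm] by blast
  have nn: "0 \<le> nrm x" and zero: "nrm x = 0 \<longleftrightarrow> x = 0" for x
    using nrm by (auto simp: norm_fun_def)
  have "nrm (A *v x) / nrm x \<le> a * (onorm ((*v) A) * b)" for x
  proof (cases "x = 0")
    case False
    have "nrm (A *v x) \<le> a * norm (A *v x)" by (rule a)
    also have "\<dots> \<le> a * (onorm ((*v) A) * (b * nrm x))"
      using a(1) b(2)[of x] onorm[OF matrix_vector_mul_bounded_linear, of A x]
        mult_left_mono[OF b(2)[of x] onorm_pos_le[OF matrix_vector_mul_bounded_linear, of A]]
      by (intro mult_left_mono) auto
    finally show ?thesis
      using False nn[of x] zero[of x] by (simp add: divide_le_eq mult.assoc)
  qed (use a(1) b(1) onorm_pos_le[OF matrix_vector_mul_bounded_linear, of A] in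
      \<open>simp add: zero[THEN iffD2]\<close>)
  then have "bdd_above (range (\<lambda>x. nrm (A *v x) / nrm x))" by (rule bdd_aboveI2)
  then have "nrm (A *v x) / nrm x \<le> op_norm nrm A"
    unfolding op_norm_def by (intro cSUP_upper) auto
  then show ?thesis
    using nn[of x] zero[of x] zero[of "A *v x"] by (cases "x = 0") (auto simp: divide_le_eq less_le)
qed

section \<open>Conversion of the hypotheses to the Euclidean norm, and conclusion\<close>

theorem theorem3p1:
  fixes nrm :: "real ^ 'n \<Rightarrow> real"
    and A :: "real \<Rightarrow> real ^ 'n ^ 'n"
    and f :: "real \<Rightarrow> real ^ 'n \<Rightarrow> real ^ 'n"
    and X :: "real \<Rightarrow> real \<Rightarrow> real ^ 'n ^ 'n"
    and M \<mu> \<gamma> K \<alpha> :: real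
  assumes "norm_fun nrm"
    and "continuous_on {0..} A"
    and "continuous_on ({0..} \<times> UNIV) (\<lambda>(t, y). f t y)"
    and "transition_matrix {0..} A X"
    and A1: "bdd_above ((\<lambda>t. op_norm nrm (A t)) ` {0..})"
            "(SUP t\<in>{0..}. op_norm nrm (A t)) = M"
    and A2: "\<mu> > 0" "\<And>t y. t \<ge> 0 \<Longrightarrow> nrm (f t y) \<le> \<mu>"
    and A3: "\<gamma> > 0" "\<And>t y y'. t \<ge> 0 \<Longrightarrow> nrm (f t y - f t y') \<le> \<gamma> * nrm (y - y')"
    and A4: "K > 0" "\<alpha> > 0"
            "\<And>t s. 0 \<le> s \<Longrightarrow> s \<le> t \<Longrightarrow> op_norm nrm (X t s) \<le> K * exp (- \<alpha> * (t - s))"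
            "2 * K * \<gamma> < \<alpha>"
  shows "continuously_topologically_equivalent nrm {0..}
           (\<lambda>t x. A t *v x) (\<lambda>t y. A t *v y + f t y)"
proof -
  note nrm = \<open>norm_fun nrm\<close>
  have nn: "0 \<le> nrm x" for x using nrm by (simp add: norm_fun_def)
  obtain a b where a: "a > 0" "\<And>x. nrm x \<le> a * norm x" and b: "b > 0" "\<And>x. norm x \<le> b * nrm x"
    using norm_fun_equivalent[OF nrm] by blast
  \<comment> \<open>The maximum provides a nonnegative bound without examining the sign of
    \<open>M\<close>.\<close>
  define N where "N = max 0 M"
  have AN: "nrm (A t *v x) \<le> N * nrm x" if "0 \<le> t" for t x
  proof -
    have "op_norm nrm (A t) \<le> M"
      unfolding A1(2)[symmetric] using that by (intro cSUP_upper A1(1)) auto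
    then have "op_norm nrm (A t) * nrm x \<le> N * nrm x"
      by (intro mult_right_mono nn) (simp add: N_def)
    with op_norm_bound[OF nrm] show ?thesis by (rule order_trans)
  qed
  \<comment> \<open>The sum \<open>N + \<gamma>\<close> is a Lipschitz constant of the perturbed
    field for \<open>nrm\<close>; the factors \<open>b\<close> and \<open>a\<close> convert it to
    the Euclidean norm. The same \<open>L\<close> serves the linear field.\<close>
  define L where "L = b * (N + \<gamma>) * a"
  have L: "L > 0" using a b \<open>\<gamma> > 0\<close> by (simp add: L_def N_def)
  have toL: "norm v \<le> L * norm x" if "nrm v \<le> (N + \<gamma>) * nrm x" for v x
  proof -
    have "norm v \<le> b * nrm v" by (rule b)
    also have "\<dots> \<le> b * ((N + \<gamma>) * (a * norm x))"
      using that a(2)[of x] b(1) \<open>\<gamma> > 0\<close> mult_left_mono[OF a(2)[of x], of "N + \<gamma>"]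
      by (intro mult_left_mono) (auto simp: N_def)
    finally show ?thesis by (simp add: L_def mult.assoc)
  qed
  have AL: "norm (A t *v x) \<le> L * norm x" if "0 \<le> t" for t x
    using AN[OF that, of x] nn[of x] \<open>\<gamma> > 0\<close> by (intro toL) (simp add: distrib_right add_increasing2)
  have lip: "norm (A t *v x + f t x - (A t *v y + f t y)) \<le> L * norm (x - y)" if "0 \<le> t" for t x y
  proof (rule toL)
    have "A t *v x + f t x - (A t *v y + f t y) = A t *v (x - y) + (f t x - f t y)"
      by (simp add: matrix_vector_mult_diff_distrib)
    also have "nrm \<dots> \<le> nrm (A t *v (x - y)) + nrm (f t x - f t y)"
      using nrm by (simp add: norm_fun_def)
    also have "\<dots> \<le> N * nrm (x - y) + \<gamma> * nrm (x - y)"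
      by (intro add_mono AN A3(2) that)
    finally show "nrm (A t *v x + f t x - (A t *v y + f t y)) \<le> (N + \<gamma>) * nrm (x - y)"
      by (simp add: distrib_right)
  qed
  have Acont: "continuous_on ({0..} \<times> UNIV) (\<lambda>(t, x). A t *v x)"
    unfolding split_beta
    by (intro bounded_bilinear.continuous_on[OF bounded_bilinear_matrix_vector] continuous_intros
        continuous_on_compose2[OF \<open>continuous_on {0..} A\<close>]) auto
  obtain \<Phi> where \<Phi>: "is_flow (\<lambda>t x. A t *v x) \<Phi>"
  proof (rule lipschitz_ode_flow[OF Acont L])
    show "norm (A t *v x - A t *v y) \<le> L * norm (x - y)" if "0 \<le> t" for t x y
      using AL[OF that, of "x - y"] by (simp add: matrix_vector_mult_diff_distrib)
    show "norm (A t *v 0) \<le> 0" for t by simp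
  qed
  obtain \<Psi> where \<Psi>: "is_flow (\<lambda>t y. A t *v y + f t y) \<Psi>"
  proof (rule lipschitz_ode_flow[OF _ L lip])
    show "continuous_on ({0..} \<times> UNIV) (\<lambda>(t, y). A t *v y + f t y)"
      using continuous_on_add[OF Acont assms(3)] by (simp add: split_beta)
    show "norm (A t *v 0 + f t 0) \<le> b * \<mu>" if "0 \<le> t" for t
      using order_trans[OF b(2)[of "f t 0"] mult_left_mono[OF A2(2)[OF that, of 0], of b]] b(1)
      by simp
  qed
  \<comment> \<open>Here \<open>K\<close> and the exponential come from the dichotomy,
    \<open>\<mu>\<close> bounds the perturbation, and \<open>b\<close> passes to the Euclidean norm;
    the factor \<open>a\<close> below leads back to \<open>nrm\<close>.\<close>
  have decay: "norm (X t s *v f s y) \<le> (b * K * \<mu>) * exp (- \<alpha> * (t - s))"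
    if "0 \<le> s" "s \<le> t" for t s y
  proof -
    have "norm (X t s *v f s y) \<le> b * nrm (X t s *v f s y)" by (rule b)
    also have "nrm (X t s *v f s y) \<le> op_norm nrm (X t s) * nrm (f s y)"
      by (rule op_norm_bound[OF nrm])
    also have "\<dots> \<le> (K * exp (- \<alpha> * (t - s))) * \<mu>"
      using that \<open>K > 0\<close> by (intro mult_mono A4(3) A2(2) nn) auto
    finally show ?thesis using b(1) by (simp add: mult_ac)
  qed
  have "nrm (\<Psi> t \<xi> - \<Phi> t \<xi>) \<le> a * (b * K * \<mu> / \<alpha>)" if "0 \<le> t" for t \<xi>
  proof -
    have "norm (\<Psi> t \<xi> - \<Phi> t \<xi>) \<le> b * K * \<mu> / \<alpha>"
      by (rule perturbed_flow_bounded_distance[OF assms(3) AL assms(4) \<Phi> \<Psi> \<open>\<alpha> > 0\<close> decay that])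
    from mult_left_mono[OF this, of a] a show ?thesis
      using order_trans by (metis less_imp_le)
  qed
  with nrm \<Phi> \<Psi> show ?thesis by (rule bounded_distance_flows_equivalent)
qed

end
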